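(* Let $0<L<U$ and $\gamma=U/L$. Consider the online knapsack problem with infinitesimal item weights and with value densities in $[L,U]$. For every $\alpha>0$, the degradation factor of the threshold algorithm $\mathrm{OKP\text{-}Alg}(\alpha)$ with respect to $\mathrm{OKP\text{-}Alg}(1)$ is $$\mathrm{DF}(\mathrm{OKP\text{-}Alg}(\alpha))=\begin{cases}\dfrac{\alpha\gamma}{\alpha+\gamma-1}, & \alpha\in[1,+\infty),\\[2mm] \dfrac{\alpha\gamma}{\alpha+\gamma^{\alpha}-1}, & \alpha\in(0,1),\end{cases}$$ that is, $\mathrm{CR}(\mathrm{OKP\text{-}Alg}(\alpha))=\mathrm{DF}(\mathrm{OKP\text{-}Alg}(\alpha))\cdot\mathrm{CR}(\mathrm{OKP\text{-}Alg}(1))$ with $\mathrm{DF}$ given by this formula.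
   Context: Online knapsack problem: items $i=1,\dots,n$ with values $v_i>0$ and weights $w_i>0$ arrive one by one ($n$ is unknown). On arrival of item $i$ the algorithm irrevocably chooses $x_i\in\{0,1\}$ (admit or reject) knowing only $(v_j,w_j)_{j\le i}$ and its past decisions. The constraint is $\sum_i w_ix_i\le 1$ and the goal is to maximize $\sum_i v_ix_i$. Standing assumptions: (1) $w_i\ll 1$ for all $i$ (infinitesimal weights); (2) $L\le v_i/w_i\le U$ for all $i$. Threshold function: with $T=1/(\ln\gamma+1)$, $$\Psi_\alpha(z)=\begin{cases}L, & z\in[0,T),\\ \min\{U,\,Le^{\alpha(z/T-1)}\}, & z\in[T,1),\\ +\infty, & z=1.\end{cases}$$ $\mathrm{OKP\text{-}Alg}(\alpha)$: start with utilization $z_0=0$. On arrival of item $i$, choose $x_i^*\in\{0,1\}$ maximizing $v_ix_i-\Psi_\alpha(z_{i-1})w_ix_i$, i.e. admit item $i$ iff $v_i/w_i\ge\Psi_\alpha(z_{i-1})$ (and the item fits in the remaining capacity). Then set $z_i=z_{i-1}+w_ix_i^*$. The competitive ratio $\mathrm{CR}$ of an algorithm is the worst-case ratio $\mathrm{OPT}/\mathrm{ALG}$ of the offline optimal value to the algorithm's value. Under assumption (1) it is understood in the infinitesimal-weight limit: the limit as $\delta\to0^+$ of the supremum of $\mathrm{OPT}/\mathrm{ALG}$ over all instances (with at least one item) satisfying (2) and $\max_i w_i\le\delta$. The degradation factor of $\mathrm{OKP\text{-}Alg}(\alpha)$ with respect to the baseline $\mathrm{OKP\text{-}Alg}(1)$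 is the worst-case performance degradation, namely the (smallest) factor with $\mathrm{CR}(\mathrm{OKP\text{-}Alg}(\alpha))\le\mathrm{DF}\cdot\mathrm{CR}(\mathrm{OKP\text{-}Alg}(1))$. *)

theory Defs
  imports "HOL-Library.Extended_Real"
begin

text \<open>An item is a pair (value, weight).\<close>

type_synonym item = "real \<times> real"

text \<open>
  A history lists the items seen so far with the decisions taken (True = admit).
  A deterministic online algorithm decides on the current item from the history alone;
  respecting the capacity is the responsibility of the algorithm.
\<close>

type_synonym history = "(item \<times> bool) list"
type_synonym online_alg = "history \<Rightarrow> item \<Rightarrow> bool"

fun run :: "online_alg \<Rightarrow> history \<Rightarrow> item list \<Rightarrow> history" where
  "run A h [] = h"
| "run A h (i # is) = run A (h @ [(i, A h i)]) is"

definition alg_value :: "online_alg \<Rightarrow> item list \<Rightarrow> real" where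
  "alg_value A I = (\<Sum>((v, w), x) \<leftarrow> run A [] I. if x then v else 0)"

definition opt_value :: "item list \<Rightarrow> real" where
  "opt_value I = Max {(\<Sum>k\<in>S. fst (I ! k)) | S.
     S \<subseteq> {..<length I} \<and> (\<Sum>k\<in>S. snd (I ! k)) \<le> 1}"

definition instances :: "real \<Rightarrow> real \<Rightarrow> real \<Rightarrow> item list set" where
  "instances L U \<delta> = {I. I \<noteq> [] \<and>
     (\<forall>(v, w) \<in> set I. v > 0 \<and> w > 0 \<and> L \<le> v / w \<and> v / w \<le> U \<and> w \<le> \<delta>)}"

text \<open>
  The quotient is taken in the extended reals, where a positive optimum over the value 0
  yields infinity (and not 0 as in the reals).
\<close>

definition worst_ratio :: "real \<Rightarrow> real \<Rightarrow> online_alg \<Rightarrow> real \<Rightarrow> ereal" where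
  "worst_ratio L U A \<delta> = (SUP I \<in> instances L U \<delta>. ereal (opt_value I) / ereal (alg_value A I))"

definition competitive_ratio :: "real \<Rightarrow> real \<Rightarrow> online_alg \<Rightarrow> ereal" where
  "competitive_ratio L U A = Lim (at_right 0) (worst_ratio L U A)"

text \<open>The limit always exists, as the worst ratio is monotone in the weight bound.\<close>

lemma worst_ratio_mono:
  assumes "\<delta> \<le> \<delta>'"
  shows "worst_ratio L U A \<delta> \<le> worst_ratio L U A \<delta>'"
  unfolding worst_ratio_def
  by (rule SUP_subset_mono) (use assms in \<open>fastforce simp: instances_def\<close>)+

lemma worst_ratio_tendsto_competitive_ratio:
  "(worst_ratio L U A \<longlongrightarrow> competitive_ratio L U A) (at_right 0)"
proof -
  have "(worst_ratio L U A \<longlongrightarrow> (INF \<delta>\<in>{0<..}. worst_ratio L U A \<delta>)) (at_right 0)"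
  proof (rule order_tendstoI)
    fix a assume "a < (INF \<delta>\<in>{0<..}. worst_ratio L U A \<delta>)"
    then have "a < worst_ratio L U A \<delta>" if "\<delta> > 0" for \<delta>
      using that by (meson INF_lower greaterThan_iff less_le_trans)
    then show "eventually (\<lambda>\<delta>. a < worst_ratio L U A \<delta>) (at_right 0)"
      by (auto simp: eventually_at_right_field intro: exI[of _ 1])
  next
    fix a assume "(INF \<delta>\<in>{0<..}. worst_ratio L U A \<delta>) < a"
    then obtain d where d: "d > 0" "worst_ratio L U A d < a"
      by (auto simp: INF_less_iff)
    then have "worst_ratio L U A \<delta> < a" if "\<delta> < d" for \<delta>
      using that worst_ratio_mono[of \<delta> d L U A] by auto
    then show "eventually (\<lambda>\<delta>. worst_ratio L U A \<delta> < a) (at_right 0)"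
      using d(1) by (auto simp: eventually_at_right_field)
  qed
  then show ?thesis
    unfolding competitive_ratio_def by (metis tendsto_Lim trivial_limit_at_right_real)
qed

definition degradation_factor :: "real \<Rightarrow> real \<Rightarrow> online_alg \<Rightarrow> online_alg \<Rightarrow> ereal" where
  "degradation_factor L U A B = Inf {d. competitive_ratio L U A \<le> d * competitive_ratio L U B}"

text \<open>Utilizations never exceed 1, so the values beyond 1 are irrelevant.\<close>

definition threshold :: "real \<Rightarrow> real \<Rightarrow> real \<Rightarrow> real \<Rightarrow> ereal" where
  "threshold L U \<alpha> z =
    (let T = 1 / (ln (U / L) + 1) in
     if z < T then ereal L
     else if z < 1 then ereal (min U (L * exp (\<alpha> * (z / T - 1))))
     else \<infinity>)"

definition utilization :: "history \<Rightarrow> real" where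
  "utilization h = (\<Sum>((v, w), x) \<leftarrow> h. if x then w else 0)"

definition OKP_Alg :: "real \<Rightarrow> real \<Rightarrow> real \<Rightarrow> online_alg" where
  "OKP_Alg L U \<alpha> h = (\<lambda>(v, w).
     threshold L U \<alpha> (utilization h) \<le> ereal (v / w) \<and> utilization h + w \<le> 1)"

end

theory Submission imports Defs begin

text \<open>
  Write \<open>\<psi>\<close> for the finite part of the threshold and \<open>G\<close> for its integral. If the algorithm ends at
  utilization \<open>z\<close>, its value is at least about \<open>G z\<close>. Either nothing was rejected (\<open>z < T\<close>) and the
  algorithm is optimal; or every rejection was due to the threshold, and pricing capacity at \<open>\<psi> z\<close>
  gives a ratio of at most \<open>\<psi> z / G z\<close>; or the capacity was exhausted and the ratio is at most
  \<open>U / G 1\<close>. With \<open>G\<close> cut off where \<open>\<psi>\<close> reaches \<open>U\<close>, the last bound dominates in all cases, for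
  \<open>\<alpha> < 1\<close> by Bernoulli's inequality. Items offered exactly at the threshold, followed by rejected
  items of density almost \<open>U\<close>, show that \<open>U / G 1\<close> is attained in the limit.
\<close>

section \<open>Runs and the histories they produce\<close>

lemma run_snoc: "run A h (I @ [i]) = (let h' = run A h I in h' @ [(i, A h' i)])"
  by (induction I arbitrary: h) (auto simp: Let_def)

lemma run_append: "run A h (I @ J) = run A (run A h I) J"
  by (induction I arbitrary: h) auto

text \<open>Each rejection lengthens the history, so the premise ranges over all numbers
  \<open>m\<close> of earlier rejections. This evaluates the adversary's tail of refused
  items.\<close>

lemma run_replicate_reject:
  assumes "\<And>m. \<not> A (h @ replicate m (i, False)) i"
  shows "run A h (replicate n i) = h @ replicate n (i, False)"
proof (induction n)
  case (Suc n)
  have "replicate (Suc n) i = replicate n i @ [i]"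
    by (simp add: replicate_append_same)
  then show ?case
    using assms Suc by (simp only: run_snoc Let_def) (simp add: replicate_append_same)
qed simp

text \<open>Lets the value be tracked next to \<open>utilization\<close> from an arbitrary
  intermediate history, which the inductions over runs require.\<close>

definition collected :: "history \<Rightarrow> real" where
  "collected h = (\<Sum>((v, w), x) \<leftarrow> h. if x then v else 0)"

lemma collected_Nil [simp]: "collected [] = 0"
  by (simp add: collected_def)

lemma collected_append [simp]: "collected (h @ h') = collected h + collected h'"
  by (simp add: collected_def)

lemma collected_single [simp]: "collected [((v, w), x)] = (if x then v else 0)"
  by (simp add: collected_def)

lemma collected_replicate_reject [simp]: "collected (replicate m (i, False)) = 0"
  by (cases i) (induction m; simp add: collected_def)

lemma utilization_Nil [simp]: "utilization [] = 0"
  by (simp add: utilization_def)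

lemma utilization_append [simp]: "utilization (h @ h') = utilization h + utilization h'"
  by (simp add: utilization_def)

lemma utilization_single [simp]: "utilization [((v, w), x)] = (if x then w else 0)"
  by (simp add: utilization_def)

lemma utilization_replicate_reject [simp]: "utilization (replicate m (i, False)) = 0"
  by (cases i) (induction m; simp add: utilization_def)

lemma alg_value_collected: "alg_value A I = collected (run A [] I)"
  by (simp add: alg_value_def collected_def)

lemma collected_run_ge:
  assumes "\<forall>(v, w) \<in> set I. v \<ge> 0"
  shows "collected h \<le> collected (run A h I)"
  using assms
proof (induction I arbitrary: h)
  case (Cons i I)
  obtain v w where i: "i = (v, w)" by (cases i)
  have "collected h \<le> collected (h @ [(i, A h i)])" using Cons.prems by (simp add: i)
  also have "\<dots> \<le> collected (run A (h @ [(i, A h i)]) I)"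
    using Cons.prems by (intro Cons.IH) auto
  finally show ?case by simp
qed simp

section \<open>The offline optimum\<close>

lemma finite_packing_values:
  "finite {(\<Sum>k\<in>S. fst (I ! k)) | S.
     S \<subseteq> {..<length I} \<and> (\<Sum>k\<in>S. snd (I ! k)) \<le> (1::real)}"
  by (rule finite_subset[of _ "(\<lambda>S. \<Sum>k\<in>S. fst (I ! k)) ` Pow {..<length I}"]) auto

lemma opt_value_ge:
  assumes "S \<subseteq> {..<length I}" "(\<Sum>k\<in>S. snd (I ! k)) \<le> 1"
  shows "(\<Sum>k\<in>S. fst (I ! k)) \<le> opt_value I"
  unfolding opt_value_def using assms by (intro Max_ge[OF finite_packing_values]) auto

text \<open>Weak duality for the fractional relaxation, with \<open>\<mu>\<close> the price of capacity.\<close>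

lemma opt_value_le_dual:
  assumes "\<mu> \<ge> 0"
  shows "opt_value I \<le> \<mu> + (\<Sum>(v, w) \<leftarrow> I. max 0 (v - \<mu> * w))"
proof -
  let ?f = "\<lambda>i. max 0 (fst i - \<mu> * snd i)"
  have "(\<Sum>k\<in>S. fst (I ! k)) \<le> \<mu> + (\<Sum>(v, w) \<leftarrow> I. max 0 (v - \<mu> * w))"
    if S: "S \<subseteq> {..<length I}" "(\<Sum>k\<in>S. snd (I ! k)) \<le> 1" for S
  proof -
    have "(\<Sum>k\<in>S. fst (I ! k)) = \<mu> * (\<Sum>k\<in>S. snd (I ! k)) + (\<Sum>k\<in>S. fst (I ! k) - \<mu> * snd (I ! k))"
      by (simp add: sum_distrib_left flip: sum.distrib)
    also have "\<dots> \<le> \<mu> * 1 + (\<Sum>k\<in>S. ?f (I ! k))"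
      using S(2) assms by (intro add_mono mult_left_mono sum_mono) auto
    also have "(\<Sum>k\<in>S. ?f (I ! k)) \<le> (\<Sum>k<length I. ?f (I ! k))"
      using S(1) by (intro sum_mono2) auto
    also have "\<dots> = (\<Sum>(v, w) \<leftarrow> I. max 0 (v - \<mu> * w))"
      by (simp add: sum_list_sum_nth atLeast0LessThan case_prod_unfold)
    finally show ?thesis by simp
  qed
  moreover have "{(\<Sum>k\<in>S. fst (I ! k)) | S.
     S \<subseteq> {..<length I} \<and> (\<Sum>k\<in>S. snd (I ! k)) \<le> 1} \<noteq> {}"
    by (auto intro!: exI[of _ "{}"])
  ultimately show ?thesis
    unfolding opt_value_def by (subst Max_le_iff[OF finite_packing_values]) auto
qed

lemma powr_le_linear:
  fixes x a :: real
  assumes "x > 0" "0 \<le> a" "a \<le> 1"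
  shows "x powr a \<le> 1 + a * (x - 1)"
proof -
  \<comment> \<open>\<^term>\<open>exp\<close> lies above its tangent at \<^term>\<open>a * ln x\<close>; average the values at \<^term>\<open>ln x\<close> and \<open>0\<close>.\<close>
  let ?c = "x powr a"
  have tangent: "?c * (1 + (y - a * ln x)) \<le> exp y" for y
  proof -
    have "?c * (1 + (y - a * ln x)) \<le> ?c * exp (y - a * ln x)"
      by (intro mult_left_mono exp_ge_add_one_self) simp
    also have "\<dots> = exp y" using assms by (simp add: powr_def flip: exp_add)
    finally show ?thesis .
  qed
  have "?c = a * (?c * (1 + (ln x - a * ln x))) + (1 - a) * (?c * (1 + (0 - a * ln x)))"
    by (simp add: algebra_simps)
  also have "\<dots> \<le> a * exp (ln x) + (1 - a) * exp 0"
    using assms by (intro add_mono mult_left_mono tangent) auto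
  finally show ?thesis using assms by (simp add: algebra_simps)
qed

section \<open>The threshold function and its potential\<close>

locale okp =
  fixes L U \<alpha> :: real
  assumes L_pos: "0 < L" and L_less_U: "L < U" and \<alpha>_pos: "0 < \<alpha>"
begin

definition "\<gamma> = U / L"
definition "T = 1 / (ln \<gamma> + 1)"
text \<open>The \<open>max\<close> merges the flat and the exponential piece of the threshold into
  one formula, with exponent 0 up to \<open>T\<close>.\<close>

definition "growth z = exp (\<alpha> * max 0 (z - T) / T)"
definition "\<psi> z = L * min \<gamma> (growth z)"

text \<open>The integral of \<^term>\<open>\<psi>\<close> over \<open>[0, z]\<close>, frozen once \<^term>\<open>\<psi>\<close> reaches \<^term>\<open>U\<close>.\<close>

definition "pot z = L * min z T + L * T / \<alpha> * (min \<gamma> (growth z) - 1)"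

lemma \<gamma>_gt_1: "\<gamma> > 1"
  using L_pos L_less_U by (simp add: \<gamma>_def)

lemma U_pos: "U > 0" and L_\<gamma>: "L * \<gamma> = U"
  using L_pos L_less_U by (auto simp: \<gamma>_def)

lemma T_pos: "0 < T" and T_less_1: "T < 1" and inverse_T: "1 / T = ln \<gamma> + 1"
proof -
  have "ln \<gamma> > 0" using \<gamma>_gt_1 by simp
  then show "0 < T" "T < 1" "1 / T = ln \<gamma> + 1" by (auto simp: T_def)
qed

lemma growth_ge_1: "growth z \<ge> 1"
  using \<alpha>_pos T_pos by (simp add: growth_def)

lemma growth_mono: "z \<le> z' \<Longrightarrow> growth z \<le> growth z'"
  using \<alpha>_pos T_pos by (auto simp: growth_def intro!: divide_right_mono mult_left_mono)

lemma growth_below: "z \<le> T \<Longrightarrow> growth z = 1"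
  by (simp add: growth_def)

text \<open>\<open>T\<close> is chosen so that \<open>(1 - T) / T = ln \<gamma>\<close>.\<close>

lemma growth_1: "growth 1 = \<gamma> powr \<alpha>"
proof -
  have "max 0 (1 - T) / T = ln \<gamma>"
    using T_pos T_less_1 inverse_T by (simp add: field_simps)
  then have "\<alpha> * max 0 (1 - T) / T = \<alpha> * ln \<gamma>" by (metis times_divide_eq_right)
  then show ?thesis using \<gamma>_gt_1 by (simp add: growth_def powr_def)
qed

lemma \<psi>_ge_L: "L \<le> \<psi> z" and \<psi>_le_U: "\<psi> z \<le> U"
proof -
  have "1 \<le> min \<gamma> (growth z)" using \<gamma>_gt_1 growth_ge_1[of z] by simp
  from mult_left_mono[OF this, of L] show "L \<le> \<psi> z" using L_pos by (simp add: \<psi>_def)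
  have "L * min \<gamma> (growth z) \<le> L * \<gamma>" using L_pos by (intro mult_left_mono) auto
  then show "\<psi> z \<le> U" by (simp add: \<psi>_def L_\<gamma>)
qed

lemma \<psi>_pos: "0 < \<psi> z"
  using \<psi>_ge_L[of z] L_pos by linarith

lemma \<psi>_mono: "z \<le> z' \<Longrightarrow> \<psi> z \<le> \<psi> z'"
  using L_pos growth_mono[of z z'] by (auto simp: \<psi>_def intro!: mult_left_mono)

lemma threshold_eq:
  assumes "z < 1"
  shows "threshold L U \<alpha> z = ereal (\<psi> z)"
proof -
  have T: "1 / (ln (U / L) + 1) = T" by (simp add: T_def \<gamma>_def)
  show ?thesis
  proof (cases "z < T")
    case True
    then show ?thesis using \<gamma>_gt_1
      unfolding threshold_def Let_def T by (simp add: \<psi>_def growth_below)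
  next
    case False
    then have "growth z = exp (\<alpha> * (z / T - 1))"
      using T_pos by (simp add: growth_def max_def diff_divide_distrib right_diff_distrib)
    moreover have "L * min \<gamma> y = min U (L * y)" for y
      using L_pos L_\<gamma> by (simp add: min_mult_distrib_left)
    ultimately show ?thesis using False assms
      unfolding threshold_def Let_def T by (simp add: \<psi>_def)
  qed
qed

text \<open>The finite \<open>\<psi>\<close> can replace the infinite threshold at full utilization,
  because there an item of positive weight fails the capacity test anyway.\<close>

lemma OKP_Alg_iff:
  assumes "w > 0"
  shows "OKP_Alg L U \<alpha> h (v, w) \<longleftrightarrow>
    \<psi> (utilization h) * w \<le> v \<and> utilization h + w \<le> 1"
proof (cases "utilization h < 1")
  case True
  then show ?thesis using assms
    by (simp add: OKP_Alg_def threshold_eq pos_le_divide_eq)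
next
  case False
  then show ?thesis using assms by (auto simp: OKP_Alg_def)
qed

text \<open>The factor is the discretization error caused by one item; it tends to 1 with
  \<open>\<delta>\<close>.\<close>

lemma \<psi>_step:
  assumes "0 \<le> w" "w \<le> \<delta>"
  shows "\<psi> (z + w) \<le> exp (\<alpha> * \<delta> / T) * \<psi> z"
proof -
  let ?K = "exp (\<alpha> * \<delta> / T)"
  have K: "?K \<ge> 1" using assms \<alpha>_pos T_pos by simp
  have "growth (z + w) \<le> exp (\<alpha> * (max 0 (z - T) + \<delta>) / T)"
    unfolding growth_def using assms \<alpha>_pos T_pos
    by (intro iffD2[OF exp_le_cancel_iff] divide_right_mono mult_left_mono) auto
  also have "\<dots> = ?K * growth z"
    by (simp add: growth_def distrib_left add_divide_distrib exp_add)
  finally have "growth (z + w) \<le> ?K * growth z" .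
  moreover have "\<gamma> \<le> ?K * \<gamma>" using K \<gamma>_gt_1 by simp
  ultimately have "min \<gamma> (growth (z + w)) \<le> ?K * min \<gamma> (growth z)"
    by (auto simp: min_def)
  from mult_left_mono[OF this, of L] L_pos show ?thesis
    by (simp add: \<psi>_def mult.left_commute)
qed

lemma growth_ratio:
  "growth z = growth z' * exp (- (\<alpha> * (max 0 (z' - T) - max 0 (z - T)) / T))"
  by (simp add: growth_def right_diff_distrib diff_divide_distrib flip: exp_add)

text \<open>Right-endpoint estimate for the integral of an increasing function, obtained from
  \<open>1 + x \<le> exp x\<close>. Freezing only lowers the increments, so the estimate survives
  it.\<close>

lemma pot_step_le:
  assumes "0 \<le> w"
  shows "pot (z + w) - pot z \<le> \<psi> (z + w) * w"
proof -
  \<comment> \<open>\<open>d\<close> is the part of the step above \<open>T\<close>, and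
    \<open>w - d\<close> the part on the flat piece.\<close>
  define d where "d = max 0 (z + w - T) - max 0 (z - T)"
  have d: "0 \<le> d" "d \<le> w" using assms by (auto simp: d_def)
  define m' where "m' = min \<gamma> (growth (z + w))"
  define m where "m = min \<gamma> (growth z)"
  have m': "m' \<ge> 1" using \<gamma>_gt_1 growth_ge_1 by (simp add: m'_def)
  have "growth z \<ge> growth (z + w) * (1 - \<alpha> * d / T)"
    using exp_ge_add_one_self[of "- (\<alpha> * d / T)"] growth_ge_1[of "z + w"]
    by (subst growth_ratio[of z "z + w"]) (auto simp: d_def intro!: mult_left_mono)
  have "\<alpha> * d / T \<ge> 0" using d \<alpha>_pos T_pos by simp
  have "m' * (1 - \<alpha> * d / T) \<le> m"
  proof (cases "1 - \<alpha> * d / T \<le> 0")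
    case True
    then have "m' * (1 - \<alpha> * d / T) \<le> 0" using m' by (simp add: mult_le_0_iff)
    also have "0 \<le> m" using \<gamma>_gt_1 growth_ge_1[of z] by (simp add: m_def)
    finally show ?thesis .
  next
    case False
    have "m' * (1 - \<alpha> * d / T) \<le> m' * 1"
      using m' \<open>\<alpha> * d / T \<ge> 0\<close> by (intro mult_left_mono) auto
    moreover have "m' * (1 - \<alpha> * d / T) \<le> growth (z + w) * (1 - \<alpha> * d / T)"
      using False by (intro mult_right_mono) (auto simp: m'_def)
    ultimately show ?thesis
      using \<open>growth z \<ge> _\<close> by (simp add: m_def) (simp add: m'_def)
  qed
  then have "L * T / \<alpha> * (m' - m) \<le> L * T / \<alpha> * (m' * (\<alpha> * d / T))"
    using L_pos T_pos \<alpha>_pos by (intro mult_left_mono) (auto simp: algebra_simps)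
  also have "\<dots> = L * m' * d" using T_pos \<alpha>_pos by (simp add: field_simps)
  finally have "L * T / \<alpha> * (m' - m) \<le> L * m' * d" .
  moreover have "min (z + w) T - min z T = w - d" by (auto simp: d_def)
  then have "L * min (z + w) T - L * min z T = L * (w - d)"
    by (metis right_diff_distrib)
  moreover have "L * (w - d) \<le> L * m' * (w - d)"
    using d m' L_pos by (intro mult_right_mono) auto
  ultimately show ?thesis
    by (simp add: pot_def \<psi>_def right_diff_distrib flip: m_def m'_def)
qed

text \<open>Left-endpoint counterpart. A frozen \<open>pot\<close> is constant while
  \<open>\<psi>\<close> stays positive, so the step must end before \<open>growth\<close> exceeds
  \<open>\<gamma>\<close>.\<close>

lemma pot_step_ge:
  assumes "0 \<le> w" "growth (z + w) \<le> \<gamma>"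
  shows "\<psi> z * w \<le> pot (z + w) - pot z"
proof -
  define d where "d = max 0 (z + w - T) - max 0 (z - T)"
  have d: "0 \<le> d" "d \<le> w" using assms by (auto simp: d_def)
  have F: "growth z \<le> \<gamma>" using growth_mono[of z "z + w"] assms by simp
  have "growth z * (1 + \<alpha> * d / T) \<le> growth z * exp (\<alpha> * d / T)"
    using growth_ge_1[of z] by (intro mult_left_mono) auto
  also have "\<dots> = growth (z + w)"
    by (simp add: growth_ratio[of "z + w" z] d_def right_diff_distrib diff_divide_distrib)
  finally have "L * T / \<alpha> * (growth z * (\<alpha> * d / T)) \<le> L * T / \<alpha> * (growth (z + w) - growth z)"
    using L_pos T_pos \<alpha>_pos by (intro mult_left_mono) (auto simp: algebra_simps)
  moreover have "L * T / \<alpha> * (growth z * (\<alpha> * d / T)) = L * growth z * d"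
    using T_pos \<alpha>_pos by (simp add: field_simps)
  ultimately have "L * growth z * d \<le> L * T / \<alpha> * (growth (z + w) - growth z)" by simp
  moreover have "min (z + w) T - min z T = w - d" by (auto simp: d_def)
  then have "L * min (z + w) T - L * min z T = L * (w - d)"
    by (metis right_diff_distrib)
  \<comment> \<open>Either the step starts above \<open>T\<close> and \<open>w - d\<close> vanishes,
    or the growth factor at \<open>z\<close> is 1.\<close>
  moreover have "L * (w - d) = L * growth z * (w - d)"
  proof (cases "z \<le> T")
    case False
    then show ?thesis using assms by (simp add: d_def)
  qed (simp add: growth_below)
  ultimately show ?thesis
    using F assms by (simp add: pot_def \<psi>_def right_diff_distrib)
qed

lemma pot_0: "pot 0 = 0"
  using \<gamma>_gt_1 T_pos by (simp add: pot_def growth_below)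

section \<open>The limiting ratio\<close>

definition "peak = min \<gamma> (\<gamma> powr \<alpha>)"
text \<open>Closed form of \<open>U / pot 1\<close>; for \<open>\<alpha> = 1\<close> it collapses to
  \<open>1 / T\<close>.\<close>

definition "ratio = \<gamma> * \<alpha> / (T * (\<alpha> + peak - 1))"

lemma peak_ge_1: "peak \<ge> 1"
  using \<gamma>_gt_1 growth_1 growth_ge_1[of 1] by (simp add: peak_def)

lemma pot_above: "T \<le> z \<Longrightarrow> pot z = L * T * (\<alpha> + min \<gamma> (growth z) - 1) / \<alpha>"
  using \<alpha>_pos by (simp add: pot_def field_simps)

lemma pot_1: "pot 1 = L * T * (\<alpha> + peak - 1) / \<alpha>"
  using T_less_1 by (simp add: pot_above growth_1 peak_def)

lemma pot_1_pos: "pot 1 > 0"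
  using L_pos T_pos \<alpha>_pos peak_ge_1 by (simp add: pot_1)

lemma ratio_eq: "ratio = U / pot 1"
proof -
  have "ratio = L * \<gamma> / pot 1" using L_pos by (simp add: pot_1 ratio_def)
  then show ?thesis by (simp add: L_\<gamma>)
qed

lemma peak_large: "\<alpha> \<ge> 1 \<Longrightarrow> peak = \<gamma>"
  using \<gamma>_gt_1 powr_mono[of 1 \<alpha> \<gamma>] by (simp add: peak_def)

lemma peak_small: "\<alpha> \<le> 1 \<Longrightarrow> peak = \<gamma> powr \<alpha>"
  using \<gamma>_gt_1 powr_mono[of \<alpha> 1 \<gamma>] by (simp add: peak_def)

text \<open>Stopping early is no worse than exhausting the capacity. With
  \<open>m = \<psi> z / L\<close>, the case \<open>\<alpha> \<ge> 1\<close> follows from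
  \<open>m \<le> \<gamma>\<close>. Otherwise Bernoulli's inequality bounds
  \<open>\<alpha> + peak - 1\<close> by \<open>\<alpha> * \<gamma>\<close>, and
  \<open>\<alpha> * m \<le> \<alpha> + m - 1\<close> finishes.\<close>

lemma \<psi>_le_ratio:
  assumes "T \<le> z" "z \<le> 1"
  shows "\<psi> z \<le> ratio * pot z"
proof -
  define m where "m = min \<gamma> (growth z)"
  have m: "1 \<le> m" "m \<le> \<gamma>" using \<gamma>_gt_1 growth_ge_1 by (auto simp: m_def)
  have "m * (\<alpha> + peak - 1) \<le> \<gamma> * (\<alpha> + m - 1)"
  proof (cases "\<alpha> \<ge> 1")
    case True
    have "m * (\<alpha> - 1) \<le> \<gamma> * (\<alpha> - 1)" using True m by (intro mult_right_mono) auto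
    then show ?thesis using True by (simp add: peak_large algebra_simps)
  next
    case False
    have "\<gamma> powr \<alpha> \<le> 1 + \<alpha> * (\<gamma> - 1)"
      using False \<alpha>_pos \<gamma>_gt_1 by (intro powr_le_linear) auto
    then have "m * (\<alpha> + peak - 1) \<le> m * (\<alpha> * \<gamma>)"
      using False m by (intro mult_left_mono) (auto simp: peak_small algebra_simps)
    also have "\<dots> = \<gamma> * (\<alpha> * m)" by simp
    also have "\<dots> \<le> \<gamma> * (\<alpha> + m - 1)"
    proof -
      have "0 \<le> (m - 1) * (1 - \<alpha>)" using m False by simp
      then show ?thesis using \<gamma>_gt_1 by (intro mult_left_mono) (auto simp: algebra_simps)
    qed
    finally show ?thesis .
  qed
  then have "m \<le> \<gamma> * (\<alpha> + m - 1) / (\<alpha> + peak - 1)"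
    using \<alpha>_pos peak_ge_1 by (simp add: pos_le_divide_eq)
  then have "L * m \<le> L * (\<gamma> * (\<alpha> + m - 1) / (\<alpha> + peak - 1))"
    using L_pos by (intro mult_left_mono) auto
  also have "\<dots> = ratio * pot z"
    using T_pos \<alpha>_pos assms by (simp add: ratio_def pot_above flip: m_def)
  finally show ?thesis by (simp add: \<psi>_def m_def)
qed

text \<open>Follows from the previous bound at \<open>z = T\<close>, where \<open>\<psi>\<close> is
  \<open>L\<close> and \<open>pot\<close> is \<open>L * T\<close>.\<close>

lemma ratio_ge_1: "ratio \<ge> 1"
proof -
  have "L \<le> ratio * (L * T)"
    using \<psi>_le_ratio[of T] T_less_1 \<gamma>_gt_1 by (simp add: \<psi>_def pot_def growth_below)
  then have "1 \<le> ratio * T" using L_pos by simp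
  also have "\<dots> \<le> ratio * 1"
    using T_less_1 pot_1_pos U_pos by (intro mult_left_mono) (auto simp: ratio_eq)
  finally show ?thesis by simp
qed

section \<open>The upper bound by an invariant and duality\<close>

text \<open>
  Here \<open>a\<close> is the value the admitted items would have if each had been sold exactly at the
  threshold. Once an item has been rejected for lack of capacity, the dual bound is lost,
  but then almost all of the capacity is used.
\<close>

lemma run_invariant:
  fixes I \<delta>
  defines "h \<equiv> run (OKP_Alg L U \<alpha>) [] I"
  assumes "\<forall>(v, w) \<in> set I. v > 0 \<and> w > 0 \<and> L \<le> v / w \<and> v / w \<le> U \<and> w \<le> \<delta>"
    and "\<delta> \<le> 1 - T"
  shows "0 \<le> utilization h \<and> utilization h \<le> 1
    \<and> (utilization h < T \<longrightarrow> (\<Sum>(v, w) \<leftarrow> I. v) = collected h)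
    \<and> (\<exists>a \<le> collected h. pot (utilization h) \<le> exp (\<alpha> * \<delta> / T) * a
        \<and> (utilization h > 1 - \<delta> \<or>
            (\<forall>\<mu> \<ge> \<psi> (utilization h).
               (\<Sum>(v, w) \<leftarrow> I. max 0 (v - \<mu> * w)) \<le> collected h - a)))"
  using assms(2) unfolding h_def
proof (induction I rule: rev_induct)
  case Nil
  then show ?case using pot_0 by (auto intro!: exI[of _ 0])
next
  case (snoc i I)
  obtain v w where i: "i = (v, w)" by (cases i)
  define h where "h = run (OKP_Alg L U \<alpha>) [] I"
  define z where "z = utilization h"
  let ?K = "exp (\<alpha> * \<delta> / T)"
  have vw: "v > 0" "w > 0" "L * w \<le> v" "v \<le> U * w" "w \<le> \<delta>"
    using snoc.prems by (auto simp: i field_simps)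
  from snoc obtain a where z: "0 \<le> z" "z \<le> 1"
    and total: "z < T \<Longrightarrow> (\<Sum>(v, w) \<leftarrow> I. v) = collected h"
    and a: "a \<le> collected h" "pot z \<le> ?K * a"
      "z > 1 - \<delta> \<or>
       (\<forall>\<mu> \<ge> \<psi> z. (\<Sum>(v, w) \<leftarrow> I. max 0 (v - \<mu> * w)) \<le> collected h - a)"
    by (auto simp flip: h_def z_def)
  show ?case
  proof (cases "OKP_Alg L U \<alpha> h i")
    case True
    then have adm: "\<psi> z * w \<le> v" "z + w \<le> 1"
      using vw by (auto simp: i OKP_Alg_iff z_def)
    have h': "run (OKP_Alg L U \<alpha>) [] (I @ [i]) = h @ [((v, w), True)]"
      using True by (simp add: run_snoc Let_def i flip: h_def)
    have "pot (z + w) \<le> pot z + \<psi> (z + w) * w"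
      using pot_step_le[of w z] vw by simp
    also have "\<dots> \<le> ?K * a + ?K * \<psi> z * w"
      using a(2) vw by (intro add_mono mult_right_mono \<psi>_step) auto
    finally have pot: "pot (z + w) \<le> ?K * (a + \<psi> z * w)"
      by (simp add: algebra_simps)
    have dual: "max 0 (v - \<mu> * w) \<le> v - \<psi> z * w" if "\<mu> \<ge> \<psi> (z + w)" for \<mu>
      using that adm \<psi>_mono[of z "z + w"] vw by auto
    have "z + w > 1 - \<delta> \<or>
       (\<forall>\<mu> \<ge> \<psi> (z + w). (\<Sum>(v, w) \<leftarrow> I. max 0 (v - \<mu> * w)) + max 0 (v - \<mu> * w)
          \<le> collected h + v - (a + \<psi> z * w))"
      using a(3)
    proof
      assume *: "\<forall>\<mu> \<ge> \<psi> z. (\<Sum>(v, w) \<leftarrow> I. max 0 (v - \<mu> * w)) \<le> collected h - a"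
      show ?thesis
      proof (intro disjI2 allI impI)
        fix \<mu> assume "\<mu> \<ge> \<psi> (z + w)"
        moreover from this have "\<mu> \<ge> \<psi> z" using \<psi>_mono[of z "z + w"] vw by simp
        ultimately show "(\<Sum>(v, w) \<leftarrow> I. max 0 (v - \<mu> * w)) + max 0 (v - \<mu> * w)
          \<le> collected h + v - (a + \<psi> z * w)"
          using * dual[of \<mu>] by fastforce
      qed
    qed (use vw in simp)
    then show ?thesis
      unfolding h' using z vw adm a(1) pot total
      by (auto simp: i simp flip: z_def intro!: exI[of _ "a + \<psi> z * w"])
  next
    case False
    have h': "run (OKP_Alg L U \<alpha>) [] (I @ [i]) = h @ [((v, w), False)]"
      using False by (simp add: run_snoc Let_def i flip: h_def)
    have rej: "v < \<psi> z * w \<or> z + w > 1"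
      using False vw by (auto simp: i OKP_Alg_iff z_def)
    \<comment> \<open>Below \<open>T\<close> every item passes the density test, and it fits because
      \<open>\<delta> \<le> 1 - T\<close>.\<close>
    have "\<not> z < T"
      using rej vw assms(3) \<gamma>_gt_1 by (auto simp: \<psi>_def growth_below)
    moreover have "z > 1 - \<delta> \<or>
       (\<forall>\<mu> \<ge> \<psi> z. (\<Sum>(v, w) \<leftarrow> I. max 0 (v - \<mu> * w)) + max 0 (v - \<mu> * w) \<le> collected h - a)"
    proof (cases "z > 1 - \<delta>")
      case False
      then have "v < \<psi> z * w" using rej vw by auto
      then have "max 0 (v - \<mu> * w) = 0" if "\<mu> \<ge> \<psi> z" for \<mu>
      proof -
        have "\<psi> z * w \<le> \<mu> * w" using that vw by (intro mult_right_mono) auto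
        then show ?thesis using \<open>v < \<psi> z * w\<close> by simp
      qed
      then show ?thesis using a(3) False by auto
    qed simp
    ultimately show ?thesis
      unfolding h' using z a(1,2) by (auto simp: i simp flip: z_def intro!: exI[of _ a])
  qed
qed

lemma opt_le_alg:
  assumes I: "I \<in> instances L U \<delta>" and \<delta>: "0 < \<delta>" "\<delta> \<le> 1 - T" "U * \<delta> < pot 1"
  shows "opt_value I \<le> exp (\<alpha> * \<delta> / T) * U / (pot 1 - U * \<delta>) * alg_value (OKP_Alg L U \<alpha>) I"
proof -
  define h where "h = run (OKP_Alg L U \<alpha>) [] I"
  define z where "z = utilization h"
  define K where "K = exp (\<alpha> * \<delta> / T)"
  define D where "D = pot 1 - U * \<delta>"
  have D: "0 < D" "D \<le> pot 1" using \<delta> U_pos by (auto simp: D_def)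
  have K: "K \<ge> 1" using \<alpha>_pos T_pos \<delta> by (simp add: K_def)
  have items: "\<forall>(v, w) \<in> set I. v > 0 \<and> w > 0 \<and> L \<le> v / w \<and> v / w \<le> U \<and> w \<le> \<delta>"
    using I by (auto simp: instances_def)
  from run_invariant[OF this \<delta>(2)] obtain a where z: "0 \<le> z" "z \<le> 1"
    and total: "z < T \<Longrightarrow> (\<Sum>(v, w) \<leftarrow> I. v) = collected h"
    and a: "a \<le> collected h" "pot z \<le> K * a"
      "z > 1 - \<delta> \<or>
       (\<forall>\<mu> \<ge> \<psi> z. (\<Sum>(v, w) \<leftarrow> I. max 0 (v - \<mu> * w)) \<le> collected h - a)"
    by (auto simp flip: h_def z_def K_def)
  have "pot z \<ge> 0"
    using z L_pos T_pos \<alpha>_pos \<gamma>_gt_1 growth_ge_1[of z] by (simp add: pot_def)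
  then have "0 \<le> K * a" using a(2) by linarith
  then have "a \<ge> 0" using K by (simp add: zero_le_mult_iff)
  then have coll: "collected h \<ge> 0" using a(1) by linarith
  have "ratio \<le> U / D" unfolding ratio_eq using D U_pos by (intro divide_left_mono) auto
  then have R: "ratio * K \<le> K * U / D" using K mult_right_mono[of ratio "U / D" K]
    by (simp add: mult.commute)
  have R1: "1 \<le> ratio * K" using ratio_ge_1 K mult_mono[of 1 ratio 1 K] by simp
  have "opt_value I \<le> K * U / D * collected h"
  proof (cases "z < T")
    case True
    \<comment> \<open>At price 0 the dual bound is the total value of the items, all of it collected
      in this case.\<close>
    have "opt_value I \<le> 0 + (\<Sum>(v, w) \<leftarrow> I. max 0 (v - 0 * w))"
      by (rule opt_value_le_dual) simp
    also have "(\<Sum>(v, w) \<leftarrow> I. max 0 (v - 0 * w)) = (\<Sum>(v, w) \<leftarrow> I. v)"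
      using items by (intro arg_cong[where f = sum_list] map_cong) (auto simp: max_def)
    also have "0 + \<dots> = collected h" using total True by simp
    also have "\<dots> \<le> K * U / D * collected h"
      using R1 R coll mult_right_mono[of 1 "K * U / D" "collected h"] by simp
    finally show ?thesis .
  next
    case False
    show ?thesis
      using a(3)
    proof
      assume full: "z > 1 - \<delta>"
      \<comment> \<open>No density exceeds \<open>U\<close>, so at this price every excess term
        vanishes.\<close>
      have "opt_value I \<le> U + (\<Sum>(v, w) \<leftarrow> I. max 0 (v - U * w))"
        using U_pos by (intro opt_value_le_dual) simp
      also have "(\<Sum>(v, w) \<leftarrow> I. max 0 (v - U * w)) = (\<Sum>(v, w) \<leftarrow> I. 0)"
        using items by (intro arg_cong[where f = sum_list] map_cong) (auto simp: field_simps)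
      finally have "opt_value I \<le> U" by (simp add: case_prod_unfold)
      have "pot 1 \<le> pot z + \<psi> 1 * (1 - z)" using pot_step_le[of "1 - z" z] z by simp
      also have "\<psi> 1 * (1 - z) \<le> U * \<delta>"
        using full z \<psi>_le_U U_pos by (intro mult_mono) auto
      finally have "D \<le> K * a" using a(2) by (simp add: D_def)
      also have "\<dots> \<le> K * collected h" using a(1) K by simp
      finally have "U * D \<le> U * (K * collected h)" using U_pos by simp
      then have "U \<le> K * U / D * collected h" using D by (simp add: field_simps)
      with \<open>opt_value I \<le> U\<close> show ?thesis by simp
    next
      assume "\<forall>\<mu> \<ge> \<psi> z. (\<Sum>(v, w) \<leftarrow> I. max 0 (v - \<mu> * w)) \<le> collected h - a"
      then have "opt_value I \<le> \<psi> z + (collected h - a)"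
        using opt_value_le_dual[of "\<psi> z" I] \<psi>_pos[of z] by fastforce
      also have "\<psi> z \<le> ratio * pot z" using False z by (intro \<psi>_le_ratio) auto
      also have "\<dots> \<le> ratio * (K * a)" using a(2) ratio_ge_1 by (intro mult_left_mono) auto
      \<comment> \<open>The surplus \<open>collected h - a\<close> is absorbed because
        \<open>ratio * K \<ge> 1\<close>.\<close>
      also have "ratio * (K * a) + (collected h - a) \<le> ratio * K * collected h"
        using mult_right_mono[OF R1, of "collected h - a"] a(1) by (simp add: algebra_simps)
      also have "\<dots> \<le> K * U / D * collected h" using R coll by (rule mult_right_mono)
      finally show ?thesis by simp
    qed
  qed
  then show ?thesis by (simp add: alg_value_collected h_def K_def D_def)
qed

lemma alg_value_pos:
  assumes I: "I \<in> instances L U \<delta>" and \<delta>: "\<delta> \<le> 1"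
  shows "alg_value (OKP_Alg L U \<alpha>) I > 0"
proof -
  obtain v w I' where eq: "I = (v, w) # I'" using I by (cases I) (auto simp: instances_def)
  have vw: "v > 0" "w > 0" "L * w \<le> v" "w \<le> 1" and I': "\<forall>(v, w) \<in> set I'. v \<ge> 0"
    using I \<delta> by (auto simp: instances_def eq field_simps)
  then have "OKP_Alg L U \<alpha> [] (v, w)"
    using T_pos \<gamma>_gt_1 by (simp add: OKP_Alg_iff \<psi>_def growth_below)
  then have "v \<le> alg_value (OKP_Alg L U \<alpha>) I"
    using collected_run_ge[OF I', of "[((v, w), True)]"] by (simp add: alg_value_collected eq)
  with vw show ?thesis by simp
qed

lemma worst_ratio_le:
  assumes "0 < \<delta>" "\<delta> \<le> 1 - T" "U * \<delta> < pot 1"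
  shows "worst_ratio L U (OKP_Alg L U \<alpha>) \<delta> \<le> ereal (exp (\<alpha> * \<delta> / T) * U / (pot 1 - U * \<delta>))"
  unfolding worst_ratio_def
proof (rule SUP_least)
  fix I assume I: "I \<in> instances L U \<delta>"
  have "alg_value (OKP_Alg L U \<alpha>) I > 0"
    using alg_value_pos[OF I] assms T_pos by simp
  then show "ereal (opt_value I) / ereal (alg_value (OKP_Alg L U \<alpha>) I)
    \<le> ereal (exp (\<alpha> * \<delta> / T) * U / (pot 1 - U * \<delta>))"
    using opt_le_alg[OF I assms] by (simp add: pos_divide_le_eq)
qed

section \<open>The lower bound by adversarial instances\<close>

text \<open>The utilization at which \<^term>\<open>\<psi>\<close> reaches its maximum on \<open>[0, 1]\<close>.\<close>

definition "zmax = min 1 (T * (1 + ln \<gamma> / \<alpha>))"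

text \<open>Since \<open>T * (1 + ln \<gamma>) = 1\<close>, the price reaches \<open>U\<close>
  within the capacity for \<open>\<alpha> \<ge> 1\<close>, while the capacity runs out first for
  \<open>\<alpha> < 1\<close>.\<close>

lemma growth_zmax: "growth zmax = peak"
proof -
  have lg: "ln \<gamma> > 0" using \<gamma>_gt_1 by simp
  have T1: "T * (1 + ln \<gamma>) = 1" using inverse_T T_pos by (simp add: field_simps)
  show ?thesis
  proof (cases "\<alpha> \<ge> 1")
    case True
    then have "ln \<gamma> / \<alpha> \<le> ln \<gamma>" using lg by (simp add: divide_le_eq)
    then have "T * (1 + ln \<gamma> / \<alpha>) \<le> T * (1 + ln \<gamma>)"
      using T_pos by (intro mult_left_mono) auto
    then have "zmax = T * (1 + ln \<gamma> / \<alpha>)" using T1 by (simp add: zmax_def)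
    then have "zmax - T = T * ln \<gamma> / \<alpha>" by (simp add: algebra_simps)
    then have "growth zmax = exp (ln \<gamma>)" using T_pos \<alpha>_pos lg by (simp add: growth_def)
    then show ?thesis using True \<gamma>_gt_1 by (simp add: peak_large)
  next
    case False
    then have "ln \<gamma> \<le> ln \<gamma> / \<alpha>" using lg \<alpha>_pos by (simp add: le_divide_eq)
    then have "T * (1 + ln \<gamma>) \<le> T * (1 + ln \<gamma> / \<alpha>)"
      using T_pos by (intro mult_left_mono) auto
    then have "zmax = 1" using T1 by (simp add: zmax_def)
    then show ?thesis using False by (simp add: peak_small growth_1)
  qed
qed

lemma zmax_gt_T: "T < zmax" and zmax_le_1: "zmax \<le> 1"
  using T_pos T_less_1 \<gamma>_gt_1 \<alpha>_pos by (auto simp: zmax_def)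

lemma pot_zmax: "pot zmax = pot 1"
  using zmax_gt_T by (simp add: pot_above growth_zmax pot_1 peak_def)

lemma \<psi>_zmax: "zmax < 1 \<Longrightarrow> \<psi> zmax = U"
proof -
  assume "zmax < 1"
  then have "zmax = T * (1 + ln \<gamma> / \<alpha>)" by (auto simp: zmax_def)
  then have "zmax - T = T * ln \<gamma> / \<alpha>" by (simp add: algebra_simps)
  then have "growth zmax = exp (ln \<gamma>)" using T_pos \<alpha>_pos \<gamma>_gt_1 by (simp add: growth_def)
  then show ?thesis using \<gamma>_gt_1 by (simp add: \<psi>_def L_\<gamma>)
qed

lemma run_fill:
  assumes "0 < w" "real n * w \<le> zmax" "k \<le> n"
  defines "h \<equiv> run (OKP_Alg L U \<alpha>) [] (map (\<lambda>i. (\<psi> (real i * w) * w, w)) [0..<k])"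
  shows "utilization h = real k * w \<and> collected h \<le> pot (real k * w)"
  using assms(3) unfolding h_def
proof (induction k)
  case 0
  then show ?case by (simp add: pot_0)
next
  case (Suc k)
  define h where "h = run (OKP_Alg L U \<alpha>) [] (map (\<lambda>i. (\<psi> (real i * w) * w, w)) [0..<k])"
  have h: "utilization h = real k * w" "collected h \<le> pot (real k * w)"
    using Suc by (auto simp: h_def)
  have "real (Suc k) * w \<le> real n * w" using Suc.prems assms(1) by (intro mult_right_mono) auto
  then have le: "real k * w + w \<le> zmax" using assms(2) by (simp add: algebra_simps)
  then have "OKP_Alg L U \<alpha> h (\<psi> (real k * w) * w, w)"
    using assms(1) zmax_le_1 by (simp add: OKP_Alg_iff h)
  then have eq: "run (OKP_Alg L U \<alpha>) [] (map (\<lambda>i. (\<psi> (real i * w) * w, w)) [0..<Suc k])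
      = h @ [((\<psi> (real k * w) * w, w), True)]"
    by (simp add: run_snoc Let_def flip: h_def)
  have "growth (real k * w + w) \<le> \<gamma>"
    using growth_mono[OF le] by (simp add: growth_zmax peak_def)
  then have "\<psi> (real k * w) * w \<le> pot (real k * w + w) - pot (real k * w)"
    using assms(1) by (intro pot_step_ge) auto
  then show ?case
    unfolding eq using h by (simp add: algebra_simps)
qed

text \<open>
  The adversary offers items exactly at the threshold until \<^term>\<open>\<psi>\<close> stops growing, and then
  items worth slightly less than \<^term>\<open>U\<close> per unit of weight, all of which are rejected: by the
  threshold if \<open>zmax < 1\<close>, by the capacity if \<open>zmax = 1\<close>.
\<close>

lemma worst_ratio_ge:
  assumes \<delta>: "0 < \<delta>" "\<delta> \<le> 1 - L / U"
  shows "ereal ((1 - \<delta>)\<^sup>2 * U / pot 1) \<le> worst_ratio L U (OKP_Alg L U \<alpha>) \<delta>"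
proof -
  have zmax_pos: "zmax > 0" using T_pos zmax_gt_T by simp
  \<comment> \<open>\<open>n\<close> is so large that \<open>n\<close> equal weights with sum
    exactly \<open>zmax\<close> are each at most \<open>\<delta>\<close>.\<close>
  obtain n where n: "zmax / \<delta> < real n" using reals_Archimedean2 by blast
  have "0 < zmax / \<delta>" using zmax_pos \<delta> by simp
  then have n0: "n > 0" using n by (cases n) auto
  define w where "w = zmax / real n"
  have w: "0 < w" "w \<le> \<delta>" "real n * w = zmax"
    using n n0 \<delta> zmax_pos by (auto simp: w_def field_simps)
  \<comment> \<open>Strictly below \<open>U\<close>, so that a threshold of \<open>U\<close>
    rejects, yet at least \<open>L\<close> by the bound on \<open>\<delta>\<close>.\<close>
  define d where "d = (1 - \<delta>) * U"
  have d: "L \<le> d" "d < U"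
    using \<delta> U_pos by (auto simp: d_def field_simps)
  define m where "m = nat \<lfloor>1 / w\<rfloor>"
  have m: "real m * w \<le> 1" "1 - w \<le> real m * w"
  proof -
    have "real m = of_int \<lfloor>1 / w\<rfloor>" using w by (simp add: m_def)
    then have "real m \<le> 1 / w" "1 / w - 1 \<le> real m" by linarith+
    then show "real m * w \<le> 1" "1 - w \<le> real m * w" using w by (auto simp: field_simps)
  qed
  define F where "F = map (\<lambda>i. (\<psi> (real i * w) * w, w)) [0..<n]"
  define I where "I = F @ replicate m (d * w, w)"
  define h where "h = run (OKP_Alg L U \<alpha>) [] F"
  have h: "utilization h = zmax" "collected h \<le> pot 1"
    using run_fill[of w n n] w pot_zmax by (auto simp: h_def F_def)
  have "\<not> OKP_Alg L U \<alpha> (h @ replicate k ((d * w, w), False)) (d * w, w)" for k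
  proof (cases "zmax < 1")
    case True
    then show ?thesis using w d by (simp add: OKP_Alg_iff h \<psi>_zmax)
  next
    case False
    then show ?thesis using w by (simp add: OKP_Alg_iff h)
  qed
  then have "alg_value (OKP_Alg L U \<alpha>) I = collected h"
    by (simp add: alg_value_collected I_def run_append run_replicate_reject flip: h_def)
  then have alg: "alg_value (OKP_Alg L U \<alpha>) I \<le> pot 1" using h by simp
  have I: "I \<in> instances L U \<delta>"
    using n0 w d L_pos \<psi>_pos \<psi>_ge_L \<psi>_le_U by (auto simp: instances_def I_def F_def)
  have "\<delta> \<le> 1" using \<delta> L_pos U_pos by (smt (verit) divide_pos_pos)
  have pos: "alg_value (OKP_Alg L U \<alpha>) I > 0" using alg_value_pos[OF I \<open>\<delta> \<le> 1\<close>] .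
  have nth: "I ! k = (d * w, w)" if "k \<in> {n..<n + m}" for k
    using that by (auto simp: I_def F_def nth_append)
  have "real m * (d * w) \<le> opt_value I"
  proof -
    have "{n..<n + m} \<subseteq> {..<length I}" by (auto simp: I_def F_def)
    from opt_value_ge[OF this] show ?thesis using m nth by simp
  qed
  moreover have "(1 - \<delta>) * d \<le> real m * w * d"
    using m w d L_pos by (intro mult_right_mono) auto
  ultimately have opt: "(1 - \<delta>)\<^sup>2 * U \<le> opt_value I"
    by (simp add: d_def power2_eq_square mult_ac)
  have "(1 - \<delta>)\<^sup>2 * U / pot 1 \<le> opt_value I / alg_value (OKP_Alg L U \<alpha>) I"
    using opt alg pos U_pos order_trans[OF _ opt, of 0] by (intro frac_le) auto
  then have "ereal ((1 - \<delta>)\<^sup>2 * U / pot 1)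
      \<le> ereal (opt_value I) / ereal (alg_value (OKP_Alg L U \<alpha>) I)"
    using pos by simp
  also have "\<dots> \<le> worst_ratio L U (OKP_Alg L U \<alpha>) \<delta>"
    unfolding worst_ratio_def using I by (rule SUP_upper)
  finally show ?thesis .
qed

section \<open>The infinitesimal limit and the degradation factor\<close>

theorem competitive_ratio_OKP_Alg: "competitive_ratio L U (OKP_Alg L U \<alpha>) = ereal ratio"
proof -
  let ?lo = "\<lambda>\<delta>. (1 - \<delta>)\<^sup>2 * U / pot 1"
  let ?hi = "\<lambda>\<delta>. exp (\<alpha> * \<delta> / T) * U / (pot 1 - U * \<delta>)"
  have small: "eventually (\<lambda>\<delta>. \<delta> \<in> {0<..<c}) (at_right 0)" if "c > 0" for c :: real
    using that by (rule eventually_at_right_real)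
  have "L / U < 1" using L_pos L_less_U by simp
  then have lo: "eventually (\<lambda>\<delta>. ereal (?lo \<delta>) \<le> worst_ratio L U (OKP_Alg L U \<alpha>) \<delta>) (at_right 0)"
    using small[of "1 - L / U"] by (auto elim!: eventually_mono intro: worst_ratio_ge)
  have "min (1 - T) (pot 1 / U) > 0" using T_less_1 pot_1_pos U_pos by simp
  from small[OF this]
  have hi: "eventually (\<lambda>\<delta>. worst_ratio L U (OKP_Alg L U \<alpha>) \<delta> \<le> ereal (?hi \<delta>)) (at_right 0)"
  proof (rule eventually_mono)
    fix \<delta> assume "\<delta> \<in> {0<..<min (1 - T) (pot 1 / U)}"
    then have "0 < \<delta>" "\<delta> \<le> 1 - T" "U * \<delta> < pot 1"
      using U_pos by (auto simp: pos_less_divide_eq mult.commute)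
    then show "worst_ratio L U (OKP_Alg L U \<alpha>) \<delta> \<le> ereal (?hi \<delta>)" by (rule worst_ratio_le)
  qed
  have "(?lo \<longlongrightarrow> ratio) (at_right 0)"
    using pot_1_pos by (auto intro!: tendsto_eq_intros simp: ratio_eq)
  moreover have "(?hi \<longlongrightarrow> ratio) (at_right 0)"
    using pot_1_pos T_pos by (auto intro!: tendsto_eq_intros simp: ratio_eq)
  ultimately have "(worst_ratio L U (OKP_Alg L U \<alpha>) \<longlongrightarrow> ereal ratio) (at_right 0)"
    using tendsto_sandwich[OF lo hi] by simp
  then show ?thesis
    using worst_ratio_tendsto_competitive_ratio tendsto_unique trivial_limit_at_right_real by blast
qed

end

theorem theorem3p1:
  fixes L U \<gamma> \<alpha> DF :: real
  assumes "0 < L" and "L < U" and "\<gamma> = U / L" and "\<alpha> > 0"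
    and "DF = (if \<alpha> \<ge> 1 then \<alpha> * \<gamma> / (\<alpha> + \<gamma> - 1)
               else \<alpha> * \<gamma> / (\<alpha> + \<gamma> powr \<alpha> - 1))"
  shows "degradation_factor L U (OKP_Alg L U \<alpha>) (OKP_Alg L U 1) = ereal DF
    \<and> competitive_ratio L U (OKP_Alg L U \<alpha>)
           = ereal DF * competitive_ratio L U (OKP_Alg L U 1)"
proof -
  interpret A: okp L U \<alpha> using assms by unfold_locales
  interpret B: okp L U 1 using assms by unfold_locales auto
  define r where "r = 1 / A.T"
  have r: "r > 0" using A.T_pos by (simp add: r_def)
  have \<gamma>: "A.\<gamma> = \<gamma>" "B.\<gamma> = \<gamma>" using assms by (auto simp: A.\<gamma>_def B.\<gamma>_def)
  have "B.T = A.T" by (simp add: A.T_def B.T_def \<gamma>)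
  then have B: "competitive_ratio L U (OKP_Alg L U 1) = ereal r"
    using B.competitive_ratio_OKP_Alg A.\<gamma>_gt_1
    by (simp add: B.ratio_def B.peak_large \<gamma> r_def)
  have "A.ratio = DF * r"
    using A.peak_large A.peak_small by (simp add: A.ratio_def assms(5) r_def \<gamma> mult_ac)
  then have A: "competitive_ratio L U (OKP_Alg L U \<alpha>) = ereal (DF * r)"
    using A.competitive_ratio_OKP_Alg by simp
  \<comment> \<open>As \<open>r\<close> is positive and finite, it cancels for every extended real
    \<open>d\<close>; the feasible factors form a closed ray whose infimum is attained.\<close>
  have "{d. ereal (DF * r) \<le> d * ereal r} = {ereal DF..}"
  proof (rule set_eqI)
    fix d show "d \<in> {d. ereal (DF * r) \<le> d * ereal r} \<longleftrightarrow> d \<in> {ereal DF..}"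
      using r by (cases d) auto
  qed
  then show ?thesis
    by (simp add: degradation_factor_def A B)
qed

end
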